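(* Let $M\ge0$ and $N\ge1$ be integers. Let $X_1,\ldots,X_M,Y_1,\ldots,Y_N$ be independent random variables with $X_i\sim N(0,\sigma_{X_i}^2)$ and $Y_j\sim N(0,\sigma_{Y_j}^2)$, let $Z=X/Y$ with $X=X_1\cdots X_M$ and $Y=Y_1\cdots Y_N$, let $f_Z$ be the probability density function of $Z$, and let $\overline{F}_Z(z)=\mathbb{P}(Z>z)$. Then, as $|z|\to\infty$, $$f_Z(z)\sim\frac{2^{(M+N-2)/2}\sigma_M}{\pi^{(N+M)/2}(N-1)!\,s_N}\,\frac{(\ln|z|)^{N-1}}{z^2}.$$ Also, as $z\to\infty$, $$\overline{F}_Z(z)\sim\frac{2^{(M+N-2)/2}\sigma_M}{\pi^{(M+N)/2}(N-1)!\,s_N}\,\frac{(\ln(z))^{N-1}}{z}.$$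
   Context: All standard deviations $\sigma_{X_i},\sigma_{Y_j}$ are positive. Notation: $\sigma_M=\sigma_{X_1}\cdots\sigma_{X_M}$ and $s_N=\sigma_{Y_1}\cdots\sigma_{Y_N}$. Empty products are $1$: thus $\sigma_0=1$ and $X=1$ when $M=0$. The density $f_Z$ is taken to be the version that is continuous on $\mathbb{R}\setminus\{0\}$. The notation $f\sim g$ means that the ratio $f/g$ tends to $1$ in the stated limit. *)

theory Defs
  imports "HOL-Probability.Probability" "HOL-Library.Landau_Symbols"
begin

text \<open>
  A Lebesgue density is only determined almost everywhere, and its value at 0 stays arbitrary here
  (the density of a ratio of products of Gaussians may have a pole at 0). Away from 0, continuity
  determines it uniquely.
\<close>
definition pdf_cont_off_zero :: "'a measure \<Rightarrow> ('a \<Rightarrow> real) \<Rightarrow> (real \<Rightarrow> real) \<Rightarrow> bool" where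
  "pdf_cont_off_zero P Z f \<longleftrightarrow>
     (\<forall>z. 0 \<le> f z) \<and> distributed P lborel Z (\<lambda>z. ennreal (f z)) \<and> continuous_on (UNIV - {0}) f"

text \<open>On the null event where the denominator vanishes the quotient is 0.\<close>
definition prod_ratio ::
  "nat \<Rightarrow> nat \<Rightarrow> (nat \<Rightarrow> 'a \<Rightarrow> real) \<Rightarrow> (nat \<Rightarrow> 'a \<Rightarrow> real) \<Rightarrow> 'a \<Rightarrow> real" where
  "prod_ratio M N X Y \<omega> = (\<Prod>i=1..M. X i \<omega>) / (\<Prod>j=1..N. Y j \<omega>)"

end

theory Submission
  imports Defs
begin

text \<open>
  If \<open>U\<close> has density \<open>f\<close> and \<open>W\<close> is independent of \<open>U\<close> and almost surely nonzero, then \<open>U W\<close>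
  has density \<open>g z = E (f (z / W) / \<bar>W\<bar>)\<close>. Start from \<open>1 / Y\<^sub>1\<close>, for which \<open>z\<^sup>2 f z\<close> tends to the
  normal density at 0. Multiplying by a normal \<open>X\<close> multiplies this limit by \<open>E \<bar>X\<bar>\<close>, by dominated
  convergence. Multiplying by a further \<open>1 / Y\<close> gives
  \<open>z\<^sup>2 g z = E (F (z Y) / \<bar>Y\<bar>)\<close> with \<open>F t = t\<^sup>2 f t \<sim> c ln t ^ k\<close>; the range \<open>1 / z < \<bar>Y\<bar> < 1\<close>
  contributes \<open>2 c / (k + 1)\<close> times the density of \<open>Y\<close> at 0 times \<open>ln z ^ (k + 1)\<close>, so each
  denominator after the first adds one logarithm.
\<close>

section \<open>Change of variables on the real line\<close>

text \<open>The classical formula speaks of absolute integrability over the Lebesgue completion; for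
  Borel functions this agrees with integrability over \<open>lborel\<close>. The equivalence of
  integrability is kept so that finiteness, not only the value, can be carried along a
  substitution.\<close>

lemma lborel_change_of_variables:
  fixes f g h :: "real \<Rightarrow> real"
  assumes S: "S \<in> sets borel" "g ` S \<in> sets borel"
    and der: "\<And>x. x \<in> S \<Longrightarrow> (g has_field_derivative h x) (at x within S)"
    and inj: "inj_on g S"
    and f: "f \<in> borel_measurable borel"
    and fg: "(\<lambda>x. indicator S x * (\<bar>h x\<bar> * f (g x))) \<in> borel_measurable borel"
  shows "integrable lborel (\<lambda>x. indicator S x * (\<bar>h x\<bar> * f (g x))) \<longleftrightarrow>
           integrable lborel (\<lambda>x. indicator (g ` S) x * f x)" (is "?I1 \<longleftrightarrow> ?I2")
    and "(\<integral>x. indicator S x * (\<bar>h x\<bar> * f (g x)) \<partial>lborel) =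
           (\<integral>x. indicator (g ` S) x * f x \<partial>lborel)" (is "?V1 = ?V2")
proof -
  have f': "(\<lambda>x. indicator (g ` S) x * f x) \<in> borel_measurable borel"
    using f S by measurable
  have a1: "(\<lambda>x. \<bar>h x\<bar> * f (g x)) absolutely_integrable_on S \<longleftrightarrow> ?I1"
    unfolding set_integrable_def real_scaleR_def
    by (rule integrable_completion) (simp add: fg)
  have a2: "f absolutely_integrable_on (g ` S) \<longleftrightarrow> ?I2"
    unfolding set_integrable_def real_scaleR_def
    by (rule integrable_completion) (simp add: f')
  have S': "S \<in> sets lebesgue" using S(1) by auto
  note cov = has_absolute_integral_change_of_variables_1'[OF S' der inj, of f]
  show eq: "?I1 \<longleftrightarrow> ?I2" using cov a1 a2 by blast
  show "?V1 = ?V2"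
  proof (cases ?I1)
    case True
    then have "?V1 = integral S (\<lambda>x. \<bar>h x\<bar> * f (g x))"
      using set_borel_integral_eq_integral(2)[of S "\<lambda>x. \<bar>h x\<bar> * f (g x)"]
      by (simp add: set_integrable_def set_lebesgue_integral_def)
    moreover have "?V2 = integral (g ` S) f"
      using True eq set_borel_integral_eq_integral(2)[of "g ` S" f]
      by (simp add: set_integrable_def set_lebesgue_integral_def)
    ultimately show ?thesis using cov a1 a2 True eq by metis
  next
    \<comment> \<open>Without integrability both Bochner integrals are 0 by convention.\<close>
    case False
    then show ?thesis using eq by (simp add: not_integrable_integral_eq)
  qed
qed

section \<open>Elementary bounds for the normal density and the exponential\<close>

lemma normal_density_le_0: "normal_density 0 \<sigma> x \<le> normal_density 0 \<sigma> 0"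
  unfolding normal_density_def by (intro mult_left_mono) auto

lemma normal_density_even: "normal_density 0 \<sigma> (- x) = normal_density 0 \<sigma> x"
  by (simp add: normal_density_def)

lemma continuous_on_normal_density: "continuous_on A (normal_density 0 \<sigma>)"
  unfolding normal_density_def divide_inverse by (intro continuous_intros)

text \<open>With \<open>t = x^2 / (2 * \<sigma>^2)\<close> this is
  \<open>t * exp (- t) \<le> 1\<close>, a consequence of \<open>t \<le> exp t\<close>.\<close>

lemma square_mult_normal_density_le:
  assumes "\<sigma> > 0"
  shows "x\<^sup>2 * normal_density 0 \<sigma> x \<le> 2 * \<sigma>\<^sup>2 * normal_density 0 \<sigma> 0"
proof -
  define t where "t = x\<^sup>2 / (2 * \<sigma>\<^sup>2)"
  have "t * exp (- t) \<le> exp t * exp (- t)"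
    using exp_ge_add_one_self[of t] by (intro mult_right_mono) (linarith | simp)+
  then have "t * exp (- t) \<le> 1" by (simp flip: exp_add)
  then have "2 * \<sigma>\<^sup>2 * normal_density 0 \<sigma> 0 * (t * exp (- t)) \<le> 2 * \<sigma>\<^sup>2 * normal_density 0 \<sigma> 0"
    by (intro mult_left_le) auto
  also have "2 * \<sigma>\<^sup>2 * normal_density 0 \<sigma> 0 * (t * exp (- t)) = x\<^sup>2 * normal_density 0 \<sigma> x"
    using assms by (simp add: normal_density_def t_def)
  finally show ?thesis .
qed

text \<open>Follows from \<open>\<bar>x\<bar> \<le> 1 + x^2\<close> and the previous bound. Read at
  \<open>x = 1 / z\<close>, it bounds \<open>\<bar>z\<bar>\<close> times the density of
  \<open>1 / Y\<close>.\<close>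

lemma abs_mult_normal_density_le:
  assumes "\<sigma> > 0"
  shows "\<bar>x\<bar> * normal_density 0 \<sigma> x \<le> (1 + 2 * \<sigma>\<^sup>2) * normal_density 0 \<sigma> 0"
proof -
  have "0 \<le> (\<bar>x\<bar> - 1)\<^sup>2" by simp
  then have "2 * \<bar>x\<bar> \<le> 1 + x\<^sup>2" by (simp add: power2_eq_square algebra_simps)
  then have "\<bar>x\<bar> \<le> 1 + x\<^sup>2" using abs_ge_zero[of x] by linarith
  then have "\<bar>x\<bar> * normal_density 0 \<sigma> x \<le> (1 + x\<^sup>2) * normal_density 0 \<sigma> x"
    by (intro mult_right_mono) auto
  also have "\<dots> \<le> (1 + 2 * \<sigma>\<^sup>2) * normal_density 0 \<sigma> 0"
    using square_mult_normal_density_le[OF assms, of x] normal_density_le_0[of \<sigma> x]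
    by (simp add: algebra_simps)
  finally show ?thesis .
qed

text \<open>The left side, divided by \<open>fact k\<close>, is a single term of the exponential
  series.\<close>

lemma power_le_fact_mult_exp:
  fixes x :: real
  assumes "x \<ge> 0"
  shows "x ^ k \<le> fact k * exp x"
proof -
  have "(\<Sum>n\<in>{k}. x ^ n /\<^sub>R fact n) \<le> (\<Sum>n. x ^ n /\<^sub>R fact n)"
    using assms by (intro sum_le_suminf summable_exp_generic) auto
  then show ?thesis by (simp add: exp_def field_simps)
qed

text \<open>On the positive half-line this is the exponential density of rate 1, and evenness
  supplies the other half. It becomes the majorant for dominated convergence in the logarithmic
  scale.\<close>

lemma integrable_exp_minus_abs: "integrable lborel (\<lambda>x::real. exp (- \<bar>x\<bar>))"
proof -
  have "prob_space (density lborel (exponential_density 1))"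
    by (rule prob_space_exponential_density) simp
  then have "(\<integral>\<^sup>+x. ennreal (exponential_density 1 x) \<partial>lborel) = 1"
    using prob_space.emeasure_space_1 by (fastforce simp: emeasure_density)
  then have "integrable lborel (exponential_density 1)"
    by (intro integrableI_nonneg) (auto simp: erlang_density_nonneg)
  moreover have "exponential_density 1 = (\<lambda>x. indicator {0..} x *\<^sub>R exp (- \<bar>x\<bar>))"
    by (auto simp: exponential_density_def fun_eq_iff)
  ultimately have "has_bochner_integral lborel (\<lambda>x. indicator {0..} x *\<^sub>R exp (- \<bar>x::real\<bar>))
      (integral\<^sup>L lborel (exponential_density 1))"
    by (metis has_bochner_integral_integrable)
  from has_bochner_integral_even_function[OF this] show ?thesis
    by (auto intro: integrable.intros)
qed

section \<open>Densities with a logarithmic tail, and products with an independent factor\<close>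

text \<open>The invariant of the induction over the factors. Evenness reduces both tails to the one
  at \<open>at_top\<close>; the global bound on \<open>\<bar>z\<bar> * f z\<close> tolerates a pole
  at 0 of order at most 1 and feeds dominated convergence.\<close>

definition log_tail_pdf ::
  "'a measure \<Rightarrow> ('a \<Rightarrow> real) \<Rightarrow> nat \<Rightarrow> real \<Rightarrow> (real \<Rightarrow> real) \<Rightarrow> bool" where
  "log_tail_pdf P Z k c f \<longleftrightarrow>
     pdf_cont_off_zero P Z f \<and> (\<forall>z. f (- z) = f z) \<and> (\<exists>C. \<forall>z. \<bar>z\<bar> * f z \<le> C) \<and>
     ((\<lambda>z. z\<^sup>2 * f z / ln z ^ k) \<longlongrightarrow> c) at_top"

lemma borel_measurable_pdf_cont_off_zero:
  assumes "pdf_cont_off_zero P Z f"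
  shows "f \<in> borel_measurable borel"
proof -
  have "(\<lambda>z. ennreal (f z)) \<in> borel_measurable borel"
    using assms by (simp add: pdf_cont_off_zero_def distributed_def)
  then have "(\<lambda>z. enn2real (ennreal (f z))) \<in> borel_measurable borel"
    by measurable
  then show ?thesis using assms by (simp add: pdf_cont_off_zero_def)
qed

text \<open>Given \<open>W = w\<close> with \<open>w \<noteq> 0\<close>, scaling turns the density
  \<open>f\<close> into \<open>f (x / w) / \<bar>w\<bar>\<close>; independence and Fubini average
  this over \<open>W\<close>. The formula for \<open>g\<close> is demanded only off 0, since at 0
  the expectation may be infinite.\<close>

lemma (in prob_space) distr_mult_indep:
  fixes U W :: "'a \<Rightarrow> real"
  assumes f: "f \<in> borel_measurable borel" "\<And>z. 0 \<le> f z"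
    and U: "distributed M lborel U (\<lambda>z. ennreal (f z))"
    and indep: "indep_var borel W borel U"
    and W0: "AE \<omega> in M. W \<omega> \<noteq> 0"
    and g: "g \<in> borel_measurable borel"
    and fg: "\<And>z. z \<noteq> 0 \<Longrightarrow> (\<integral>\<^sup>+\<omega>. ennreal (f (z / W \<omega>) / \<bar>W \<omega>\<bar>) \<partial>M) = ennreal (g z)"
  shows "distributed M lborel (\<lambda>\<omega>. U \<omega> * W \<omega>) (\<lambda>z. ennreal (g z))"
proof -
  have [measurable]: "f \<in> borel_measurable borel" "g \<in> borel_measurable borel" by fact+
  have [measurable]: "random_variable borel U" "random_variable borel W"
    using indep by (auto dest: indep_var_rv1 indep_var_rv2)
  have distrU: "distr M borel U = density lborel (\<lambda>z. ennreal (f z))"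
    using U by (simp add: distributed_def cong: distr_cong)
  interpret DU: prob_space "distr M borel U" by (rule prob_space_distr) simp
  interpret L: pair_sigma_finite M lborel ..
  show ?thesis
    unfolding distributed_def
  proof (intro conjI measure_eqI)
    fix A assume "A \<in> sets (distr M lborel (\<lambda>\<omega>. U \<omega> * W \<omega>))"
    then have A[measurable]: "A \<in> sets borel" by simp
    have inner: "(\<integral>\<^sup>+u. indicator A (u * w) \<partial>distr M borel U) =
        (\<integral>\<^sup>+x. indicator A x * ennreal (f (x / w) / \<bar>w\<bar>) \<partial>lborel)" if "w \<noteq> 0" for w
    proof -
      have "(\<integral>\<^sup>+u. indicator A (u * w) \<partial>distr M borel U) =
          (\<integral>\<^sup>+u. ennreal (f u) * indicator A (u * w) \<partial>lborel)"
        unfolding distrU by (subst nn_integral_density) auto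
      \<comment> \<open>Substitution \<open>u = x / w\<close>.\<close>
      also have "\<dots> = \<bar>1 / w\<bar> *
          (\<integral>\<^sup>+x. ennreal (f (0 + 1 / w * x)) * indicator A ((0 + 1 / w * x) * w) \<partial>lborel)"
        using that by (intro nn_integral_real_affine) auto
      also have "\<dots> =
          (\<integral>\<^sup>+x. \<bar>1 / w\<bar> * (ennreal (f (0 + 1 / w * x)) * indicator A ((0 + 1 / w * x) * w)) \<partial>lborel)"
        by (rule nn_integral_cmult[symmetric]) measurable
      also have "\<dots> = (\<integral>\<^sup>+x. indicator A x * ennreal (f (x / w) / \<bar>w\<bar>) \<partial>lborel)"
        using that f(2)
        by (intro nn_integral_cong) (auto simp: indicator_def field_simps simp flip: ennreal_mult)
      finally show ?thesis .
    qed
    have "emeasure (distr M lborel (\<lambda>\<omega>. U \<omega> * W \<omega>)) A =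
        (\<integral>\<^sup>+x. indicator A x \<partial>distr M lborel (\<lambda>\<omega>. U \<omega> * W \<omega>))"
      by (simp add: A)
    also have "\<dots> = (\<integral>\<^sup>+\<omega>. indicator A (U \<omega> * W \<omega>) \<partial>M)"
      by (rule nn_integral_distr) auto
    also have "\<dots> = (\<integral>\<^sup>+p. indicator A (snd p * fst p)
        \<partial>distr M (borel \<Otimes>\<^sub>M borel) (\<lambda>\<omega>. (W \<omega>, U \<omega>)))"
      by (subst nn_integral_distr) auto
    also have "\<dots> = (\<integral>\<^sup>+p. indicator A (snd p * fst p) \<partial>(distr M borel W \<Otimes>\<^sub>M distr M borel U))"
      using indep by (simp add: indep_var_distribution_eq)
    also have "\<dots> = (\<integral>\<^sup>+w. \<integral>\<^sup>+u. indicator A (u * w) \<partial>distr M borel U \<partial>distr M borel W)"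
      by (subst DU.nn_integral_fst[symmetric]) auto
    also have "\<dots> = (\<integral>\<^sup>+\<omega>. \<integral>\<^sup>+u. indicator A (u * W \<omega>) \<partial>distr M borel U \<partial>M)"
      by (subst nn_integral_distr) auto
    also have "\<dots> = (\<integral>\<^sup>+\<omega>. \<integral>\<^sup>+x. indicator A x * ennreal (f (x / W \<omega>) / \<bar>W \<omega>\<bar>) \<partial>lborel \<partial>M)"
      using W0 by (intro nn_integral_cong_AE) (auto simp: inner)
    also have "\<dots> = (\<integral>\<^sup>+x. \<integral>\<^sup>+\<omega>. indicator A x * ennreal (f (x / W \<omega>) / \<bar>W \<omega>\<bar>) \<partial>M \<partial>lborel)"
      by (rule L.Fubini'[symmetric]) measurable
    also have "\<dots> = (\<integral>\<^sup>+x. indicator A x * (\<integral>\<^sup>+\<omega>. ennreal (f (x / W \<omega>) / \<bar>W \<omega>\<bar>) \<partial>M) \<partial>lborel)"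
      by (intro nn_integral_cong nn_integral_cmult) measurable
    also have "\<dots> = (\<integral>\<^sup>+x. ennreal (g x) * indicator A x \<partial>lborel)"
    proof (rule nn_integral_cong_AE)
      show "AE x in lborel. indicator A x * (\<integral>\<^sup>+\<omega>. ennreal (f (x / W \<omega>) / \<bar>W \<omega>\<bar>) \<partial>M) =
          ennreal (g x) * indicator A x"
        using AE_lborel_singleton[of "0::real"] by eventually_elim (auto simp: fg mult.commute)
    qed
    also have "\<dots> = emeasure (density lborel (\<lambda>x. ennreal (g x))) A"
      by (simp add: emeasure_density)
    finally show "emeasure (distr M lborel (\<lambda>\<omega>. U \<omega> * W \<omega>)) A =
        emeasure (density lborel (\<lambda>x. ennreal (g x))) A" .
  qed auto
qed

text \<open>
  Writing \<open>h z = \<bar>z\<bar> f z\<close>, multiplication by an independent \<open>W\<close> is the averaging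
  \<open>h z \<mapsto> E (h (z / W))\<close>, which visibly preserves boundedness, continuity and evenness.
\<close>
lemma (in prob_space) pdf_cont_off_zero_mult:
  fixes U W :: "'a \<Rightarrow> real"
  assumes U: "pdf_cont_off_zero M U f" and even: "\<And>z. f (- z) = f z"
    and bound: "\<And>z. \<bar>z\<bar> * f z \<le> C"
    and indep: "indep_var borel W borel U"
    and W0: "AE \<omega> in M. W \<omega> \<noteq> 0"
  defines "g \<equiv> \<lambda>z. expectation (\<lambda>\<omega>. f (z / W \<omega>) / \<bar>W \<omega>\<bar>)"
  shows "pdf_cont_off_zero M (\<lambda>\<omega>. U \<omega> * W \<omega>) g" "g (- z) = g z" "\<bar>z\<bar> * g z \<le> C"
proof -
  have f0: "0 \<le> f z" for z using U by (simp add: pdf_cont_off_zero_def)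
  have [measurable]: "f \<in> borel_measurable borel"
    using U by (rule borel_measurable_pdf_cont_off_zero)
  have [measurable]: "random_variable borel W" using indep by (rule indep_var_rv1)
  have C0: "0 \<le> C" using bound[of 0] by simp
  have g0: "0 \<le> g z" for z unfolding g_def by (intro Bochner_Integration.integral_nonneg) (simp add: f0)
  \<comment> \<open>True also for \<open>w = 0\<close>, where division by 0 makes both sides
    0.\<close>
  have h_eq: "\<bar>z\<bar> * (f (z / w) / \<bar>w\<bar>) = \<bar>z / w\<bar> * f (z / w)" for z w
    by (simp add: abs_divide)
  have int_le: "f (z / w) / \<bar>w\<bar> \<le> C / \<bar>z\<bar>" if "z \<noteq> 0" for z w
    using bound[of "z / w"] that by (simp add: h_eq[symmetric] field_simps)
  have int: "integrable M (\<lambda>\<omega>. f (z / W \<omega>) / \<bar>W \<omega>\<bar>)" if "z \<noteq> 0" for z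
    by (rule integrable_const_bound[where B="C / \<bar>z\<bar>"]) (auto simp: f0 int_le[OF that])
  have hg: "\<bar>z\<bar> * g z = expectation (\<lambda>\<omega>. \<bar>z / W \<omega>\<bar> * f (z / W \<omega>))" for z
    unfolding g_def h_eq[symmetric] by (rule integral_mult_right_zero[symmetric])
  \<comment> \<open>Continuity is shown for \<open>\<bar>z\<bar> * g z\<close> first: its integrand
    is dominated by the constant \<open>C\<close> for every \<open>z\<close>, whereas the bound for
    \<open>g\<close> itself depends on \<open>z\<close>.\<close>
  have h_cont: "continuous_on (UNIV - {0}) (\<lambda>z. \<bar>z\<bar> * g z)"
  proof (rule continuous_on_sequentiallyI)
    fix u :: "nat \<Rightarrow> real" and a assume ua: "\<forall>n. u n \<in> UNIV - {0}" "a \<in> UNIV - {0}" "u \<longlonglongrightarrow> a"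
    show "(\<lambda>n. \<bar>u n\<bar> * g (u n)) \<longlonglongrightarrow> \<bar>a\<bar> * g a"
      unfolding hg
    proof (rule integral_dominated_convergence[where w="\<lambda>_. C"])
      show "AE \<omega> in M. (\<lambda>n. \<bar>u n / W \<omega>\<bar> * f (u n / W \<omega>)) \<longlonglongrightarrow> \<bar>a / W \<omega>\<bar> * f (a / W \<omega>)"
        using W0
      proof eventually_elim
        case (elim \<omega>)
        have "isCont f (a / W \<omega>)"
          using U elim ua(2) by (auto simp: pdf_cont_off_zero_def continuous_on_eq_continuous_at open_delete)
        moreover have "(\<lambda>n. u n / W \<omega>) \<longlonglongrightarrow> a / W \<omega>"
          using elim ua by (intro tendsto_intros)
        ultimately show ?case using elim ua
          by (intro tendsto_intros isCont_tendsto_compose[of _ f]) auto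
      qed
    qed (auto simp: f0 bound abs_mult intro!: AE_I2 simp flip: abs_divide)
  qed
  have "continuous_on (UNIV - {0}) (\<lambda>z. \<bar>z\<bar> * g z / \<bar>z\<bar>)"
    by (intro continuous_intros h_cont) auto
  then have g_cont: "continuous_on (UNIV - {0}) g"
    by (rule continuous_on_eq) auto
  have g_meas: "g \<in> borel_measurable borel" unfolding g_def by measurable
  have "distributed M lborel (\<lambda>\<omega>. U \<omega> * W \<omega>) (\<lambda>z. ennreal (g z))"
  proof (rule distr_mult_indep[OF _ f0 _ indep W0 g_meas])
    show "distributed M lborel U (\<lambda>z. ennreal (f z))" using U by (simp add: pdf_cont_off_zero_def)
    fix z :: real assume "z \<noteq> 0"
    then show "(\<integral>\<^sup>+\<omega>. ennreal (f (z / W \<omega>) / \<bar>W \<omega>\<bar>) \<partial>M) = ennreal (g z)"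
      unfolding g_def by (intro nn_integral_eq_integral int) (auto simp: f0)
  qed simp
  then show "pdf_cont_off_zero M (\<lambda>\<omega>. U \<omega> * W \<omega>) g"
    using g0 g_cont by (simp add: pdf_cont_off_zero_def)
  show "g (- z) = g z" by (simp add: g_def even)
  have "expectation (\<lambda>\<omega>. \<bar>z / W \<omega>\<bar> * f (z / W \<omega>)) \<le> expectation (\<lambda>_. C)"
    by (intro integral_mono integrable_const_bound[where B=C])
       (auto simp: f0 C0 bound abs_mult simp flip: abs_divide)
  then show "\<bar>z\<bar> * g z \<le> C" by (simp add: hg prob_space)
qed

section \<open>The reciprocal of one normal variable\<close>

text \<open>The substitution \<open>y = 1 / z\<close> has Jacobian \<open>1 / z^2\<close>.
  Multiplied by \<open>z^2\<close>, the new density is the normal density at \<open>1 / z\<close>,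
  which tends to its value at 0; hence no logarithm yet.\<close>

lemma (in prob_space) log_tail_pdf_inverse_normal:
  assumes Y: "distributed M lborel Y (\<lambda>y. ennreal (normal_density 0 \<sigma> y))" and \<sigma>: "\<sigma> > 0"
  shows "log_tail_pdf M (\<lambda>\<omega>. inverse (Y \<omega>)) 0 (normal_density 0 \<sigma> 0)
    (\<lambda>z. normal_density 0 \<sigma> (inverse z) / z\<^sup>2)"
proof -
  let ?\<phi> = "normal_density 0 \<sigma>"
  let ?f = "\<lambda>z. ?\<phi> (inverse z) / z\<^sup>2"
  have [measurable]: "Y \<in> borel_measurable M" using Y by (simp add: distributed_def)
  have dist: "distributed M lborel (\<lambda>\<omega>. inverse (Y \<omega>)) (\<lambda>z. ennreal (?f z))"
    unfolding distributed_def
  proof (intro conjI measure_eqI)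
    fix A assume "A \<in> sets (distr M lborel (\<lambda>\<omega>. inverse (Y \<omega>)))"
    then have A[measurable]: "A \<in> sets borel" by simp
    let ?F = "\<lambda>y. ?\<phi> y * indicator A (inverse y) :: real"
    have S: "inverse ` (UNIV - {0}) = (UNIV - {0 :: real})"
      by (auto intro: image_eqI[where x="inverse _"])
    \<comment> \<open>At \<open>x = 0\<close> both sides vanish, because
      \<open>1 / 0 = 0\<close>.\<close>
    have ind: "indicator (UNIV - {0}) x * (\<bar>- (1 / x\<^sup>2)\<bar> * ?F (inverse x)) = indicator A x * ?f x" for x
      by (auto simp: indicator_def)
    have der: "(inverse has_field_derivative - (1 / x\<^sup>2)) (at x within UNIV - {0})"
      if "x \<noteq> 0" for x :: real
      using that by (auto intro!: derivative_eq_intros simp: power2_eq_square field_simps)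
    have inj: "inj_on inverse (UNIV - {0 :: real})" by (simp add: inj_on_def)
    have cov: "integrable lborel (\<lambda>x. indicator A x * ?f x) \<longleftrightarrow>
          integrable lborel (\<lambda>x. indicator (UNIV - {0}) x * ?F x)"
        "(\<integral>x. indicator A x * ?f x \<partial>lborel) = (\<integral>x. indicator (UNIV - {0}) x * ?F x \<partial>lborel)"
      using lborel_change_of_variables[of "UNIV - {0}" inverse "\<lambda>x. - (1 / x\<^sup>2)" ?F]
      unfolding S ind by (simp_all add: der inj)
    have ae: "AE x in lborel. indicator (UNIV - {0}) x * ?F x = ?F x"
      using AE_lborel_singleton[of "0::real"] by eventually_elim auto
    have intF: "integrable lborel ?F"
      by (rule Bochner_Integration.integrable_bound[OF integrable_normal_density[where \<mu>=0 and \<sigma>=\<sigma>]])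
         (auto simp: indicator_def \<sigma>)
    then have intf: "integrable lborel (\<lambda>x. indicator A x * ?f x)"
      unfolding cov(1) by (subst integrable_cong_AE[OF _ _ ae]) auto
    have "emeasure (distr M lborel (\<lambda>\<omega>. inverse (Y \<omega>))) A =
        (\<integral>\<^sup>+x. indicator A x \<partial>distr M lborel (\<lambda>\<omega>. inverse (Y \<omega>)))"
      by (simp add: A)
    also have "\<dots> = (\<integral>\<^sup>+\<omega>. indicator A (inverse (Y \<omega>)) \<partial>M)"
      by (rule nn_integral_distr) auto
    also have "\<dots> = (\<integral>\<^sup>+y. ennreal (?\<phi> y) * indicator A (inverse y) \<partial>lborel)"
      by (rule distributed_nn_integral[OF Y, symmetric]) simp
    also have "\<dots> = (\<integral>\<^sup>+y. ennreal (?F y) \<partial>lborel)"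
      by (intro nn_integral_cong) (auto simp: indicator_def)
    also have "\<dots> = ennreal (\<integral>y. ?F y \<partial>lborel)"
      by (intro nn_integral_eq_integral intF) auto
    also have "(\<integral>y. ?F y \<partial>lborel) = (\<integral>x. indicator A x * ?f x \<partial>lborel)"
      unfolding cov(2) by (rule integral_cong_AE[symmetric, OF _ _ ae]) auto
    also have "ennreal \<dots> = (\<integral>\<^sup>+x. ennreal (indicator A x * ?f x) \<partial>lborel)"
      by (intro nn_integral_eq_integral[symmetric] intf) auto
    also have "\<dots> = emeasure (density lborel (\<lambda>x. ennreal (?f x))) A"
      by (subst emeasure_density) (auto intro!: nn_integral_cong simp: indicator_def)
    finally show "emeasure (distr M lborel (\<lambda>\<omega>. inverse (Y \<omega>))) A =
        emeasure (density lborel (\<lambda>x. ennreal (?f x))) A" .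
  qed auto
  have "continuous_on (UNIV - {0}) ?f"
    by (intro continuous_intros continuous_on_compose2[OF continuous_on_normal_density[of UNIV]]) auto
  moreover have "\<bar>z\<bar> * ?f z \<le> (1 + 2 * \<sigma>\<^sup>2) * ?\<phi> 0" for z
  proof -
    have "\<bar>z\<bar> * ?f z = \<bar>inverse z\<bar> * ?\<phi> (inverse z)"
      by (cases "z = 0") (auto simp: power2_eq_square abs_if divide_inverse)
    then show ?thesis using abs_mult_normal_density_le[OF \<sigma>, of "inverse z"] by simp
  qed
  moreover have "((\<lambda>z. z\<^sup>2 * ?f z / ln z ^ 0) \<longlongrightarrow> ?\<phi> 0) at_top"
  proof (rule Lim_transform_eventually)
    have "isCont ?\<phi> 0"
      using continuous_on_normal_density[of UNIV] by (simp add: continuous_on_eq_continuous_at)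
    then show "((\<lambda>z. ?\<phi> (inverse z)) \<longlongrightarrow> ?\<phi> 0) at_top"
      by (rule isCont_tendsto_compose) (rule tendsto_inverse_0_at_top[OF filterlim_ident])
    show "\<forall>\<^sub>F z in at_top. ?\<phi> (inverse z) = z\<^sup>2 * ?f z / ln z ^ 0"
      using eventually_gt_at_top[of 0] by eventually_elim auto
  qed
  moreover have "?f (- z) = ?f z" for z
    using normal_density_even[of \<sigma> "inverse z"] by simp
  ultimately show ?thesis
    using dist unfolding log_tail_pdf_def pdf_cont_off_zero_def by auto
qed

lemma distributed_normal_AE_nonzero:
  assumes "distributed M lborel X (\<lambda>x. ennreal (normal_density 0 \<sigma> x))"
  shows "AE \<omega> in M. X \<omega> \<noteq> (0::real)"
proof -
  have X: "X \<in> borel_measurable M" and d: "distr M lborel X = density lborel (\<lambda>x. ennreal (normal_density 0 \<sigma> x))"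
    using assms by (auto simp: distributed_def)
  have "AE x in density lborel (\<lambda>x. ennreal (normal_density 0 \<sigma> x)). x \<noteq> 0"
    using AE_lborel_singleton[of "0::real"] by (subst AE_density) auto
  then show ?thesis
    using X by (subst (asm) d[symmetric], subst (asm) AE_distr_iff) auto
qed

section \<open>The tail after multiplying or dividing by a normal variable\<close>

text \<open>Turns the limit at infinity into a bound on all of \<open>z \<ge> 1\<close>, as
  dominated convergence requires. The base is \<open>1 + ln z\<close> since \<open>ln z\<close>
  vanishes at 1.\<close>

lemma log_tail_pdf_le:
  assumes Z: "log_tail_pdf P Z k c f"
  obtains K where "K \<ge> 0" "\<And>z. \<bar>z\<bar> * f z \<le> K" "\<And>z. z \<ge> 1 \<Longrightarrow> z\<^sup>2 * f z \<le> K * (1 + ln z) ^ k"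
proof -
  obtain C where C: "\<And>z. \<bar>z\<bar> * f z \<le> C" using Z by (auto simp: log_tail_pdf_def)
  have f0: "0 \<le> f z" for z using Z by (simp add: log_tail_pdf_def pdf_cont_off_zero_def)
  have C0: "0 \<le> C" using C[of 0] by simp
  have "\<forall>\<^sub>F z in at_top. z\<^sup>2 * f z / ln z ^ k < \<bar>c\<bar> + 1"
    using Z by (intro order_tendstoD(2)[of _ c]) (auto simp: log_tail_pdf_def)
  then obtain T where T: "\<And>z. z \<ge> T \<Longrightarrow> z\<^sup>2 * f z / ln z ^ k < \<bar>c\<bar> + 1"
    by (auto simp: eventually_at_top_linorder)
  \<comment> \<open>The three entries serve the global bound, the region
    \<open>z \<ge> \<bar>T\<bar> + exp 1\<close> where the limit governs, and the bounded rest of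
    \<open>z \<ge> 1\<close>. The summand \<open>exp 1\<close> guarantees \<open>ln z > 0\<close>
    beyond the threshold.\<close>
  define K where "K = max C (max (\<bar>c\<bar> + 1) (C * \<bar>T\<bar> + C * exp 1))"
  have K: "C \<le> K" "\<bar>c\<bar> + 1 \<le> K" "C * \<bar>T\<bar> + C * exp 1 \<le> K" by (auto simp: K_def)
  show thesis
  proof
    show "K \<ge> 0" using C0 K by linarith
    show "\<bar>z\<bar> * f z \<le> K" for z using C[of z] K by linarith
    fix z :: real assume z: "z \<ge> 1"
    have one: "1 \<le> (1 + ln z) ^ k" using z by (intro one_le_power) auto
    show "z\<^sup>2 * f z \<le> K * (1 + ln z) ^ k"
    proof (cases "z \<ge> \<bar>T\<bar> + exp 1")
      case True
      have "0 < ln z" using True exp_gt_one[of 1] by (intro ln_gt_zero) linarith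
      then have "z\<^sup>2 * f z \<le> (\<bar>c\<bar> + 1) * ln z ^ k"
        using less_imp_le[OF T[of z]] True abs_ge_self[of T] exp_gt_zero[of "1::real"]
        by (simp add: pos_divide_le_eq)
      also have "\<dots> \<le> K * (1 + ln z) ^ k"
        using K \<open>0 < ln z\<close> by (intro mult_mono power_mono) auto
      finally show ?thesis .
    next
      case False
      have "z\<^sup>2 * f z = z * (\<bar>z\<bar> * f z)" using z by (simp add: power2_eq_square)
      also have "\<dots> \<le> (\<bar>T\<bar> + exp 1) * C"
        using False z C[of z] C0 f0[of z] by (intro mult_mono) auto
      also have "\<dots> \<le> K * 1" using K by (simp add: algebra_simps)
      also have "\<dots> \<le> K * (1 + ln z) ^ k"
        using one C0 K by (intro mult_left_mono) auto
      finally show ?thesis .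
    qed
  qed
qed

text \<open>With \<open>F z = z^2 * f z\<close>, the new tail function is the expectation of
  \<open>F (z / X) * \<bar>X\<bar>\<close>. For exponent 0 the function \<open>F\<close> is bounded,
  so a multiple of \<open>\<bar>X\<bar>\<close> dominates; numerators are therefore multiplied in
  while only one denominator is present.\<close>

lemma (in prob_space) log_tail_pdf_mult_normal:
  assumes U: "log_tail_pdf M U 0 c f"
    and X: "distributed M lborel X (\<lambda>x. ennreal (normal_density 0 \<sigma> x))" and \<sigma>: "\<sigma> > 0"
    and indep: "indep_var borel X borel U"
  shows "\<exists>g. log_tail_pdf M (\<lambda>\<omega>. U \<omega> * X \<omega>) 0 (c * (\<sigma> * sqrt (2 / pi))) g"
proof -
  have Uf: "pdf_cont_off_zero M U f" "\<And>z. f (- z) = f z"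
    "((\<lambda>z. z\<^sup>2 * f z) \<longlongrightarrow> c) at_top"
    using U by (auto simp: log_tail_pdf_def)
  have f0: "0 \<le> f z" for z using Uf by (simp add: pdf_cont_off_zero_def)
  have [measurable]: "f \<in> borel_measurable borel"
    using Uf(1) by (rule borel_measurable_pdf_cont_off_zero)
  have [measurable]: "X \<in> borel_measurable M" using X by (simp add: distributed_def)
  obtain K where K: "K \<ge> 0" "\<And>z. \<bar>z\<bar> * f z \<le> K" "\<And>z. z \<ge> 1 \<Longrightarrow> z\<^sup>2 * f z \<le> K"
    by (rule log_tail_pdf_le[OF U]) auto
  have absf: "f \<bar>z\<bar> = f z" for z using Uf(2)[of z] by (simp add: abs_if)
  \<comment> \<open>Evenness covers \<open>\<bar>z\<bar> \<ge> 1\<close>; nearer to 0 the extra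
    factor \<open>\<bar>z\<bar>\<close> is at most 1.\<close>
  have F_le: "z\<^sup>2 * f z \<le> K" for z
  proof (cases "\<bar>z\<bar> \<ge> 1")
    case True
    then show ?thesis using K(3)[of "\<bar>z\<bar>"] by (simp add: absf)
  next
    case False
    have "z\<^sup>2 * f z = \<bar>z\<bar> * (\<bar>z\<bar> * f z)" by (simp add: power2_eq_square)
    also have "\<dots> \<le> 1 * (\<bar>z\<bar> * f z)" using False f0 by (intro mult_right_mono) auto
    also have "\<dots> \<le> K" using K(2) by simp
    finally show ?thesis .
  qed
  note X0 = distributed_normal_AE_nonzero[OF X]
  define g where "g z = expectation (\<lambda>\<omega>. f (z / X \<omega>) / \<bar>X \<omega>\<bar>)" for z
  note g = pdf_cont_off_zero_mult[OF Uf(1,2) K(2) indep X0, folded g_def]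
  have absX: "integrable M (\<lambda>\<omega>. \<bar>X \<omega>\<bar>)" "expectation (\<lambda>\<omega>. \<bar>X \<omega>\<bar>) = \<sigma> * sqrt (2 / pi)"
  proof -
    \<comment> \<open>The first absolute moment of the centred normal law.\<close>
    have *: "has_bochner_integral lborel (\<lambda>x. normal_density 0 \<sigma> x * \<bar>x\<bar>) (\<sigma> * sqrt (2 / pi))"
      using normal_moment_abs_odd[OF \<sigma>, of 0 0] by simp
    show "integrable M (\<lambda>\<omega>. \<bar>X \<omega>\<bar>)"
      using * by (subst distributed_integrable[OF X, symmetric]) (auto intro: integrable.intros)
    show "expectation (\<lambda>\<omega>. \<bar>X \<omega>\<bar>) = \<sigma> * sqrt (2 / pi)"
      using * by (subst distributed_integral[OF X, symmetric]) (auto intro: has_bochner_integral_integral_eq)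
  qed
  have "((\<lambda>z. expectation (\<lambda>\<omega>. (z / X \<omega>)\<^sup>2 * f (z / X \<omega>) * \<bar>X \<omega>\<bar>)) \<longlongrightarrow>
      expectation (\<lambda>\<omega>. c * \<bar>X \<omega>\<bar>)) at_top"
  proof (rule integral_dominated_convergence_at_top[where w="\<lambda>\<omega>. K * \<bar>X \<omega>\<bar>"])
    show "AE \<omega> in M. ((\<lambda>z. (z / X \<omega>)\<^sup>2 * f (z / X \<omega>) * \<bar>X \<omega>\<bar>) \<longlongrightarrow> c * \<bar>X \<omega>\<bar>) at_top"
      using X0
    proof eventually_elim
      case (elim \<omega>)
      have "filterlim (\<lambda>z. z / \<bar>X \<omega>\<bar>) at_top at_top"
        using elim by (intro filterlim_tendsto_pos_mult_at_top[OF tendsto_const _ filterlim_ident, of "1 / \<bar>X \<omega>\<bar>", simplified]) auto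
      from filterlim_compose[OF Uf(3) this]
      have "((\<lambda>z. (z / \<bar>X \<omega>\<bar>)\<^sup>2 * f (z / \<bar>X \<omega>\<bar>)) \<longlongrightarrow> c) at_top" .
      moreover have "(z / \<bar>X \<omega>\<bar>)\<^sup>2 * f (z / \<bar>X \<omega>\<bar>) = (z / X \<omega>)\<^sup>2 * f (z / X \<omega>)" for z
        using absf[of "z / X \<omega>"] absf[of "z / \<bar>X \<omega>\<bar>"] by (simp add: power_divide abs_divide)
      ultimately show ?case by (intro tendsto_intros) simp
    qed
  qed (use absX F_le f0 in \<open>auto simp: abs_mult intro!: mult_right_mono always_eventually AE_I2\<close>)
  also have "expectation (\<lambda>\<omega>. c * \<bar>X \<omega>\<bar>) = c * (\<sigma> * sqrt (2 / pi))" by (simp add: absX)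
  finally have lim: "((\<lambda>z. expectation (\<lambda>\<omega>. (z / X \<omega>)\<^sup>2 * f (z / X \<omega>) * \<bar>X \<omega>\<bar>)) \<longlongrightarrow>
      c * (\<sigma> * sqrt (2 / pi))) at_top" .
  have "z\<^sup>2 * g z = expectation (\<lambda>\<omega>. (z / X \<omega>)\<^sup>2 * f (z / X \<omega>) * \<bar>X \<omega>\<bar>)" for z
  proof -
    have "z\<^sup>2 * (f (z / x) / \<bar>x\<bar>) = (z / x)\<^sup>2 * f (z / x) * \<bar>x\<bar>" for x
      by (simp add: power2_eq_square divide_simps)
    then show ?thesis by (simp add: g_def flip: integral_mult_right_zero)
  qed
  then have "log_tail_pdf M (\<lambda>\<omega>. U \<omega> * X \<omega>) 0 (c * (\<sigma> * sqrt (2 / pi))) g"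
    using g lim by (auto simp: log_tail_pdf_def)
  then show ?thesis by blast
qed

text \<open>
  In the logarithmic scale \<open>y = z powr (x - 1)\<close> the new tail function \<open>z\<^sup>2 g z / ln z ^ (k + 1)\<close>
  becomes an integral over \<open>x\<close> whose integrand tends to \<open>c x ^ k\<close> times the normal density at 0
  for \<open>0 < x < 1\<close> and vanishes elsewhere.
\<close>
lemma (in prob_space) log_tail_pdf_divide_normal:
  assumes U: "log_tail_pdf M U k c f"
    and Y: "distributed M lborel Y (\<lambda>y. ennreal (normal_density 0 \<sigma> y))" and \<sigma>: "\<sigma> > 0"
    and indep: "indep_var borel (\<lambda>\<omega>. inverse (Y \<omega>)) borel U"
  shows "\<exists>g. log_tail_pdf M (\<lambda>\<omega>. U \<omega> * inverse (Y \<omega>)) (Suc k)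
    (2 * normal_density 0 \<sigma> 0 * c / real (Suc k)) g"
proof -
  let ?\<phi> = "normal_density 0 \<sigma>"
  define F where "F = (\<lambda>z. z\<^sup>2 * f z)"
  have Uf: "pdf_cont_off_zero M U f" "\<And>z. f (- z) = f z"
    "((\<lambda>z. F z / ln z ^ k) \<longlongrightarrow> c) at_top"
    using U by (auto simp: log_tail_pdf_def F_def)
  have f0: "0 \<le> f z" for z using Uf by (simp add: pdf_cont_off_zero_def)
  have F0: "0 \<le> F z" for z by (simp add: F_def f0)
  have [measurable]: "f \<in> borel_measurable borel"
    using Uf(1) by (rule borel_measurable_pdf_cont_off_zero)
  have [measurable]: "F \<in> borel_measurable borel" unfolding F_def by measurable
  obtain K where K: "K \<ge> 0" "\<And>z. \<bar>z\<bar> * f z \<le> K" "\<And>z. z \<ge> 1 \<Longrightarrow> F z \<le> K * (1 + ln z) ^ k"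
    by (rule log_tail_pdf_le[OF U, folded F_def]) (auto simp: F_def)
  have Y0: "AE \<omega> in M. inverse (Y \<omega>) \<noteq> 0"
    using distributed_normal_AE_nonzero[OF Y] by simp
  define g where "g z = expectation (\<lambda>\<omega>. f (z / inverse (Y \<omega>)) / \<bar>inverse (Y \<omega>)\<bar>)" for z
  note g = pdf_cont_off_zero_mult[OF Uf(1,2) K(2) indep Y0, folded g_def]
  let ?I = "\<lambda>L x. ?\<phi> (exp ((x - 1) * L)) * F (exp (x * L)) / L ^ k"
  \<comment> \<open>Here \<open>L = ln z\<close>. Evenness folds the integral over \<open>y\<close>
    onto the positive half-line, whence the factor 2. The substitution
    \<open>y = exp ((x - 1) * L)\<close> gives \<open>z * y = exp (x * L)\<close> and Jacobian
    \<open>L * y\<close>; its \<open>L\<close> lowers \<open>L ^ Suc k\<close> to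
    \<open>L ^ k\<close>.\<close>
  have g_eq: "(exp L)\<^sup>2 * g (exp L) / L ^ Suc k = 2 * (\<integral>x. ?I L x \<partial>lborel)" if L: "L > 0" for L
  proof -
    let ?G = "\<lambda>y. ?\<phi> y * (f (exp L * y) * \<bar>y\<bar>)"
    have le: "f (exp L * y) * \<bar>y\<bar> \<le> K / exp L" for y
      using K(2)[of "exp L * y"] by (simp add: abs_mult field_simps)
    have int: "integrable lborel ?G"
    proof (rule Bochner_Integration.integrable_bound)
      show "integrable lborel (\<lambda>y. ?\<phi> y * (K / exp L))"
        using integrable_normal_density[where \<mu>=0 and \<sigma>=\<sigma>] \<sigma> by simp
      show "AE y in lborel. norm (?G y) \<le> norm (?\<phi> y * (K / exp L))"
        using le f0 K(1)
        by (intro AE_I2) (auto simp: abs_mult simp del: times_divide_eq_right intro!: mult_left_mono)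
    qed simp
    have img: "range (\<lambda>x. exp ((x - 1) * L)) = {0<..}"
    proof -
      have "x \<in> range (\<lambda>x. exp ((x - 1) * L))" if "x > 0" for x
        using that L by (intro image_eqI[where x="ln x / L + 1"]) auto
      then show ?thesis by auto
    qed
    have "g (exp L) = (\<integral>y. ?G y \<partial>lborel)"
      unfolding g_def by (subst distributed_integral[OF Y]) (auto simp: field_simps)
    also have "\<dots> = 2 * (\<integral>y. indicator {0..} y *\<^sub>R ?G y \<partial>lborel)"
    proof -
      have "integrable lborel (\<lambda>y. indicator {0..} y *\<^sub>R ?G y)"
        by (intro integrable_mult_indicator int) auto
      from has_bochner_integral_even_function[OF has_bochner_integral_integrable[OF this]]
      show ?thesis
        using Uf(2) by (simp add: has_bochner_integral_iff normal_density_even)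
    qed
    \<comment> \<open>The endpoint 0 may be dropped because the factor \<open>\<bar>y\<bar>\<close>
      vanishes there.\<close>
    also have "(\<lambda>y. indicator {0..} y *\<^sub>R ?G y) = (\<lambda>y. indicator {0<..} y * ?G y)"
      by (auto simp: indicator_def)
    also have "(\<integral>y. indicator {0<..} y * ?G y \<partial>lborel) =
        (\<integral>x. indicator UNIV x * (\<bar>exp ((x - 1) * L) * L\<bar> * ?G (exp ((x - 1) * L))) \<partial>lborel)"
      unfolding img[symmetric]
      by (rule lborel_change_of_variables(2)[symmetric])
         (use L in \<open>auto simp: img inj_on_def intro!: derivative_eq_intros\<close>)
    also have "\<dots> = (\<integral>x. L / (exp L)\<^sup>2 * (?\<phi> (exp ((x - 1) * L)) * F (exp (x * L))) \<partial>lborel)"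
    proof (rule Bochner_Integration.integral_cong)
      fix x
      have e: "exp ((x - 1) * L) = exp (x * L) / exp L" by (simp add: left_diff_distrib exp_diff)
      show "indicator UNIV x * (\<bar>exp ((x - 1) * L) * L\<bar> * ?G (exp ((x - 1) * L))) =
          L / (exp L)\<^sup>2 * (?\<phi> (exp ((x - 1) * L)) * F (exp (x * L)))"
        using L unfolding e by (simp add: F_def power2_eq_square field_simps)
    qed simp
    also have "\<dots> = L / (exp L)\<^sup>2 * (\<integral>x. ?\<phi> (exp ((x - 1) * L)) * F (exp (x * L)) \<partial>lborel)"
      by (rule integral_mult_right_zero)
    finally show ?thesis using L by (simp add: field_simps)
  qed
  \<comment> \<open>Collected from the case \<open>x \<ge> 0\<close>:
    \<open>2 * \<sigma>^2 + 1\<close> comes from the decay of the normal density,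
    \<open>fact k\<close> from trading the power for an exponential, and \<open>exp 3\<close> from
    \<open>exp (2 - 2 * x) * exp (1 + x) = exp 3 * exp (- x)\<close>.\<close>
  define B where "B = (2 * \<sigma>\<^sup>2 + 1) * ?\<phi> 0 * exp 3 * K * fact k"
  have B0: "0 \<le> B" using K(1) by (simp add: B_def)
  have bound: "?I L x \<le> B * exp (- \<bar>x\<bar>)" if L: "L \<ge> 1" for L x
  proof (cases "x < 0")
    case True
    \<comment> \<open>For \<open>x < 0\<close> the constants are simply enlarged to fit
      \<open>B\<close>.\<close>
    have K1: "K \<le> exp 3 * K * fact k"
    proof -
      have "1 * K * 1 \<le> exp 3 * K * fact k"
        using K(1) by (intro mult_mono) (auto simp: fact_ge_1)
      then show ?thesis by simp
    qed
    have "F (exp (x * L)) = exp (x * L) * (\<bar>exp (x * L)\<bar> * f (exp (x * L)))"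
      by (simp add: F_def power2_eq_square)
    also have "\<dots> \<le> exp (- \<bar>x\<bar>) * K"
      using True L f0 K(1) K(2)[of "exp (x * L)"] by (intro mult_mono) (auto simp: mult_le_cancel_left1)
    finally have "?\<phi> (exp ((x - 1) * L)) * F (exp (x * L)) \<le> ?\<phi> 0 * (exp (- \<bar>x\<bar>) * K)"
      using F0 by (intro mult_mono normal_density_le_0) auto
    also have "\<dots> = (1 * ?\<phi> 0) * K * exp (- \<bar>x\<bar>)" by simp
    also have "\<dots> \<le> ((2 * \<sigma>\<^sup>2 + 1) * ?\<phi> 0) * (exp 3 * K * fact k) * exp (- \<bar>x\<bar>)"
      using K K1 by (intro mult_right_mono mult_mono) auto
    also have "\<dots> = B * exp (- \<bar>x\<bar>)" by (simp add: B_def)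
    finally have *: "?\<phi> (exp ((x - 1) * L)) * F (exp (x * L)) \<le> B * exp (- \<bar>x\<bar>)" .
    have "?I L x \<le> ?\<phi> (exp ((x - 1) * L)) * F (exp (x * L)) / 1"
      using L F0 by (intro divide_left_mono) auto
    then show ?thesis using * by simp
  next
    case False
    \<comment> \<open>The rate 2 in the exponent is what outweighs the factor
      \<open>exp (1 + x)\<close> coming from \<open>F\<close>. For \<open>x > 1\<close> it results
      from the bound on \<open>E^2 * ?\<phi> E\<close>, as \<open>L \<ge> 1\<close> makes
      \<open>E^2\<close> at least \<open>exp (2 * x - 2)\<close>.\<close>
    have phi: "?\<phi> (exp ((x - 1) * L)) \<le> (2 * \<sigma>\<^sup>2 + 1) * ?\<phi> 0 * exp (2 - 2 * x)"
    proof (cases "x \<le> 1")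
      case True
      have "?\<phi> (exp ((x - 1) * L)) \<le> 1 * ?\<phi> 0 * 1" using normal_density_le_0 by simp
      also have "\<dots> \<le> (2 * \<sigma>\<^sup>2 + 1) * ?\<phi> 0 * exp (2 - 2 * x)"
        using True by (intro mult_mono) auto
      finally show ?thesis .
    next
      case F: False
      define E where "E = exp ((x - 1) * L)"
      have "(x - 1) * 1 \<le> (x - 1) * L" using F L by (intro mult_left_mono) auto
      from add_mono[OF this this] have "2 * x - 2 \<le> (x - 1) * L + (x - 1) * L"
        by simp
      then have "exp (2 * x - 2) \<le> exp ((x - 1) * L + (x - 1) * L)"
        by (subst exp_le_cancel_iff)
      then have E: "exp (2 * x - 2) \<le> E\<^sup>2"
        by (simp only: E_def power2_eq_square exp_add)
      have "exp (2 * x - 2) * ?\<phi> E \<le> E\<^sup>2 * ?\<phi> E" using E by (intro mult_right_mono) auto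
      also have "\<dots> \<le> 2 * \<sigma>\<^sup>2 * ?\<phi> 0" by (rule square_mult_normal_density_le[OF \<sigma>])
      also have "\<dots> \<le> (2 * \<sigma>\<^sup>2 + 1) * ?\<phi> 0" by (intro mult_right_mono) auto
      finally have "?\<phi> E \<le> (2 * \<sigma>\<^sup>2 + 1) * ?\<phi> 0 / exp (2 * x - 2)"
        by (simp add: field_simps)
      also have "\<dots> = (2 * \<sigma>\<^sup>2 + 1) * ?\<phi> 0 * exp (2 - 2 * x)"
        by (simp add: exp_diff)
      finally show ?thesis by (simp add: E_def)
    qed
    have "F (exp (x * L)) \<le> K * (1 + x * L) ^ k"
      using K(3)[of "exp (x * L)"] False L by simp
    \<comment> \<open>Uses \<open>1 \<le> L\<close>, so that \<open>L ^ k\<close> cancels against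
      the denominator.\<close>
    also have "\<dots> \<le> K * ((1 + x) * L) ^ k"
      using False L K by (intro mult_left_mono power_mono) (auto simp: algebra_simps)
    finally have "F (exp (x * L)) / L ^ k \<le> K * (1 + x) ^ k"
      using L by (simp add: power_mult_distrib pos_divide_le_eq mult.assoc)
    also have "\<dots> \<le> K * (fact k * exp (1 + x))"
      using False K by (intro mult_left_mono power_le_fact_mult_exp) auto
    finally have "?\<phi> (exp ((x - 1) * L)) * (F (exp (x * L)) / L ^ k) \<le>
        (2 * \<sigma>\<^sup>2 + 1) * ?\<phi> 0 * exp (2 - 2 * x) * (K * (fact k * exp (1 + x)))"
      using phi F0 L by (intro mult_mono) auto
    also have "\<dots> = (2 * \<sigma>\<^sup>2 + 1) * ?\<phi> 0 * K * fact k * (exp (2 - 2 * x) * exp (1 + x))"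
      by simp
    also have "exp (2 - 2 * x) * exp (1 + x) = exp 3 * exp (- \<bar>x\<bar>)"
      using False by (simp flip: exp_add)
    finally show ?thesis by (simp add: B_def mult_ac)
  qed
  \<comment> \<open>The pointwise limit off the null set of the two endpoints 0 and 1.\<close>
  let ?J = "\<lambda>x::real. indicator {0..1} x * (?\<phi> 0 * (c * x ^ k))"
  have ptwise: "((\<lambda>L. ?I L x) \<longlongrightarrow> ?J x) at_top" if x: "x \<noteq> 0" "x \<noteq> 1" for x
  proof (cases "x < 0")
    case True
    have lim: "((\<lambda>L. ?\<phi> 0 * K * exp (x * L)) \<longlongrightarrow> 0) at_top"
      using True
      by (intro tendsto_mult_right_zero filterlim_compose[OF exp_at_bot]
            filterlim_tendsto_neg_mult_at_bot[OF tendsto_const] filterlim_ident) auto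
    have "((\<lambda>L. ?I L x) \<longlongrightarrow> 0) at_top"
    proof (rule tendsto_sandwich[OF _ _ tendsto_const lim])
      show "\<forall>\<^sub>F L in at_top. 0 \<le> ?I L x"
        using eventually_ge_at_top[of 1] by eventually_elim (simp add: F0)
      show "\<forall>\<^sub>F L in at_top. ?I L x \<le> ?\<phi> 0 * K * exp (x * L)"
        using eventually_ge_at_top[of 1]
      proof eventually_elim
        case (elim L)
        have "F (exp (x * L)) = \<bar>exp (x * L)\<bar> * f (exp (x * L)) * exp (x * L)"
          by (simp add: F_def power2_eq_square)
        also have "\<dots> \<le> K * exp (x * L)" using K(2)[of "exp (x * L)"] by (intro mult_right_mono) auto
        finally have "?\<phi> (exp ((x - 1) * L)) * F (exp (x * L)) \<le> ?\<phi> 0 * (K * exp (x * L))"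
          using F0 by (intro mult_mono normal_density_le_0) auto
        moreover have "?I L x \<le> ?\<phi> (exp ((x - 1) * L)) * F (exp (x * L)) / 1"
          using elim F0 by (intro divide_left_mono) auto
        ultimately show ?case by simp
      qed
    qed
    then show ?thesis using True by simp
  next
    case False
    then have x0: "x > 0" using x by simp
    have xL: "filterlim (\<lambda>L. x * L) at_top at_top"
      using x0 by (intro filterlim_tendsto_pos_mult_at_top[OF tendsto_const]) (auto simp: filterlim_ident)
    \<comment> \<open>The tail of \<open>F\<close> is read at \<open>exp (x * L)\<close>, whose
      logarithm is \<open>x * L\<close>.\<close>
    from filterlim_compose[OF Uf(3) filterlim_compose[OF exp_at_top xL]]
    have "((\<lambda>L. F (exp (x * L)) / (x * L) ^ k * x ^ k) \<longlongrightarrow> c * x ^ k) at_top"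
      by (intro tendsto_intros) simp
    moreover have "\<forall>\<^sub>F L in at_top. F (exp (x * L)) / (x * L) ^ k * x ^ k = F (exp (x * L)) / L ^ k"
      using eventually_gt_at_top[of 0] by eventually_elim (use x0 in \<open>simp add: power_mult_distrib\<close>)
    ultimately have Flim: "((\<lambda>L. F (exp (x * L)) / L ^ k) \<longlongrightarrow> c * x ^ k) at_top"
      by (rule Lim_transform_eventually)
    \<comment> \<open>The normal density acts as a cutoff at \<open>x = 1\<close>: its argument
      tends to 0 for \<open>x < 1\<close> and to infinity for \<open>x > 1\<close>.\<close>
    have "((\<lambda>L. ?\<phi> (exp ((x - 1) * L))) \<longlongrightarrow> indicator {0..1} x * ?\<phi> 0) at_top"
    proof (cases "x < 1")
      case True
      have "isCont ?\<phi> 0"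
        using continuous_on_normal_density[of UNIV] by (simp add: continuous_on_eq_continuous_at)
      then have "((\<lambda>L. ?\<phi> (exp ((x - 1) * L))) \<longlongrightarrow> ?\<phi> 0) at_top"
        using True
        by (intro isCont_tendsto_compose[of _ ?\<phi>] filterlim_compose[OF exp_at_bot]
            filterlim_tendsto_neg_mult_at_bot[OF tendsto_const] filterlim_ident) auto
      then show ?thesis using True x0 by simp
    next
      case False
      have l: "((\<lambda>L. 2 * \<sigma>\<^sup>2 * ?\<phi> 0 * exp (- (2 * (x - 1)) * L)) \<longlongrightarrow> 0) at_top"
        using False x
        by (intro tendsto_mult_right_zero filterlim_compose[OF exp_at_bot]
            filterlim_tendsto_neg_mult_at_bot[OF tendsto_const] filterlim_ident) auto
      have "((\<lambda>L. ?\<phi> (exp ((x - 1) * L))) \<longlongrightarrow> 0) at_top"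
      proof (rule tendsto_sandwich[OF _ _ tendsto_const l])
        show "\<forall>\<^sub>F L in at_top. ?\<phi> (exp ((x - 1) * L)) \<le> 2 * \<sigma>\<^sup>2 * ?\<phi> 0 * exp (- (2 * (x - 1)) * L)"
        proof (rule always_eventually, rule allI)
          fix L
          have "(exp ((x - 1) * L))\<^sup>2 * ?\<phi> (exp ((x - 1) * L)) \<le> 2 * \<sigma>\<^sup>2 * ?\<phi> 0"
            by (rule square_mult_normal_density_le[OF \<sigma>])
          then have "?\<phi> (exp ((x - 1) * L)) \<le> 2 * \<sigma>\<^sup>2 * ?\<phi> 0 / (exp ((x - 1) * L))\<^sup>2"
            by (simp add: field_simps)
          also have "\<dots> = 2 * \<sigma>\<^sup>2 * ?\<phi> 0 * exp (- (2 * (x - 1)) * L)"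
          proof -
            have "- (2 * (x - 1)) * L = - (2 * ((x - 1) * L))" by (simp add: algebra_simps)
            then show ?thesis by (simp only: exp_minus divide_inverse exp_double)
          qed
          finally show "?\<phi> (exp ((x - 1) * L)) \<le> 2 * \<sigma>\<^sup>2 * ?\<phi> 0 * exp (- (2 * (x - 1)) * L)" .
        qed
      qed simp
      then show ?thesis using False x by simp
    qed
    from tendsto_mult[OF this Flim] show ?thesis by (simp add: mult_ac)
  qed
  have "((\<lambda>L. \<integral>x. ?I L x \<partial>lborel) \<longlongrightarrow> (\<integral>x. ?J x \<partial>lborel)) at_top"
  proof (rule integral_dominated_convergence_at_top[where w="\<lambda>x. B * exp (- \<bar>x\<bar>)"])
    show "integrable lborel (\<lambda>x. B * exp (- \<bar>x\<bar>))"
      using integrable_exp_minus_abs by simp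
    show "AE x in lborel. ((\<lambda>L. ?I L x) \<longlongrightarrow> ?J x) at_top"
      using AE_lborel_singleton[of "0::real"] AE_lborel_singleton[of "1::real"]
      by eventually_elim (rule ptwise)
    show "\<forall>\<^sub>F L in at_top. AE x in lborel. norm (?I L x) \<le> B * exp (- \<bar>x\<bar>)"
      using eventually_ge_at_top[of 1]
      by eventually_elim (use bound F0 in \<open>auto intro!: AE_I2 simp: abs_mult\<close>)
  qed measurable
  also have "(\<integral>x. ?J x \<partial>lborel) = (\<integral>x. ?\<phi> 0 * c * (x ^ k * indicator {0..1} x) \<partial>lborel)"
    by (simp add: mult_ac)
  \<comment> \<open>The integral of \<open>x ^ k\<close> over the unit interval produces the divisor
    \<open>Suc k\<close>.\<close>
  also have "\<dots> = ?\<phi> 0 * c / real (Suc k)"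
    by (subst integral_mult_right_zero, subst integral_power) auto
  finally have "((\<lambda>L. \<integral>x. ?I L x \<partial>lborel) \<longlongrightarrow> ?\<phi> 0 * c / real (Suc k)) at_top" .
  from filterlim_compose[OF tendsto_mult[OF tendsto_const[of 2] this] ln_at_top]
  have "((\<lambda>z. 2 * (\<integral>x. ?I (ln z) x \<partial>lborel)) \<longlongrightarrow> 2 * ?\<phi> 0 * c / real (Suc k)) at_top"
    by (simp add: mult.assoc)
  moreover have "\<forall>\<^sub>F z in at_top. 2 * (\<integral>x. ?I (ln z) x \<partial>lborel) = z\<^sup>2 * g z / ln z ^ Suc k"
    using eventually_gt_at_top[of 1] by eventually_elim (subst g_eq[symmetric], auto)
  ultimately have "((\<lambda>z. z\<^sup>2 * g z / ln z ^ Suc k) \<longlongrightarrow> 2 * ?\<phi> 0 * c / real (Suc k)) at_top"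
    by (rule Lim_transform_eventually)
  then have "log_tail_pdf M (\<lambda>\<omega>. U \<omega> * inverse (Y \<omega>)) (Suc k) (2 * ?\<phi> 0 * c / real (Suc k)) g"
    using g by (auto simp: log_tail_pdf_def)
  then show ?thesis by blast
qed

section \<open>Uniqueness of the density off 0\<close>

text \<open>Two densities agree almost everywhere, and by continuity the set of nonzero points where
  they differ is open; an open null set is empty.\<close>

lemma pdf_cont_off_zero_unique:
  assumes f: "pdf_cont_off_zero P Z f" and g: "pdf_cont_off_zero P Z g" and z: "z \<noteq> 0"
  shows "f z = g z"
proof -
  have "density lborel (\<lambda>x. ennreal (f x)) = density lborel (\<lambda>x. ennreal (g x))"
    using f g by (simp add: pdf_cont_off_zero_def distributed_def)
  moreover have [measurable]: "f \<in> borel_measurable borel" "g \<in> borel_measurable borel"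
    using f g by (auto intro: borel_measurable_pdf_cont_off_zero)
  ultimately have "AE x in lborel. ennreal (f x) = ennreal (g x)"
    by (intro sigma_finite_measure.density_unique[OF sigma_finite_lborel]) auto
  then have "AE x in lborel. f x = g x"
    by eventually_elim (use f g in \<open>simp add: pdf_cont_off_zero_def\<close>)
  then have ae: "AE x in lebesgue. x \<in> - {x. x \<in> UNIV - {0} \<and> f x - g x \<in> - {0}}"
    by (intro AE_completion) auto
  have "continuous_on (UNIV - {0}) (\<lambda>x. f x - g x)"
    using f g by (auto simp: pdf_cont_off_zero_def intro!: continuous_intros)
  then have "open ((UNIV - {0}) \<inter> (\<lambda>x. f x - g x) -` (- {0}))"
    by (rule continuous_open_preimage) auto
  moreover have "(UNIV - {0}) \<inter> (\<lambda>x. f x - g x) -` (- {0}) = {x. x \<in> UNIV - {0} \<and> f x - g x \<in> - {0}}"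
    by auto
  ultimately have "closed (- {x. x \<in> UNIV - {0} \<and> f x - g x \<in> - {0}})"
    by (simp add: closed_def)
  from mem_closed_if_AE_lebesgue[OF this ae, of z] show ?thesis using z by auto
qed

section \<open>From the tail of the density to the tail probability\<close>

lemma tendsto_ln_power_div_at_top: "((\<lambda>z::real. ln z ^ k / z) \<longlongrightarrow> 0) at_top"
proof (rule Lim_transform_eventually)
  show "((\<lambda>z::real. ln z ^ k / exp (ln z)) \<longlongrightarrow> 0) at_top"
    by (rule filterlim_compose[OF tendsto_power_div_exp_0 ln_at_top])
  show "\<forall>\<^sub>F z in at_top. ln z ^ k / exp (ln z) = ln z ^ k / (z::real)"
    using eventually_gt_at_top[of 0] by eventually_elim simp
qed

text \<open>
  The density is compared with \<open>- G'\<close> where \<open>G z = ln z ^ k / z\<close>, since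
  \<open>- z\<^sup>2 G' z = ln z ^ k - k ln z ^ (k - 1)\<close>.
\<close>
lemma (in prob_space) tail_prob_asymp:
  assumes Z: "distributed M lborel Z (\<lambda>z. ennreal (f z))" and f0: "\<And>z. 0 \<le> f z"
    and [measurable]: "f \<in> borel_measurable borel"
    and lim: "((\<lambda>z. z\<^sup>2 * f z / ln z ^ k) \<longlongrightarrow> c) at_top" and c: "c > 0"
  shows "(\<lambda>z. prob {\<omega> \<in> space M. Z \<omega> > z}) \<sim>[at_top] (\<lambda>z. c * (ln z ^ k / z))"
proof -
  define G where "G = (\<lambda>z::real. ln z ^ k / z)"
  \<comment> \<open>The derivative of \<open>- G\<close>. For \<open>k = 0\<close> the truncated
    \<open>k - 1\<close> is harmless, as its term has the factor \<open>real k\<close>.\<close>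
  define G' where "G' = (\<lambda>z::real. (ln z ^ k - real k * ln z ^ (k - 1)) / z\<^sup>2)"
  have [measurable]: "G' \<in> borel_measurable borel" unfolding G'_def by measurable
  have [measurable]: "Z \<in> borel_measurable M" using Z by (simp add: distributed_def)
  have G: "((\<lambda>z. - G z) has_field_derivative G' z) (at z)" if "z > 0" for z
    unfolding G_def G'_def using that
    by (auto intro!: derivative_eq_intros simp: field_simps power2_eq_square)
  have ratio: "((\<lambda>z. z\<^sup>2 * G' z / ln z ^ k) \<longlongrightarrow> 1) at_top"
  proof (rule Lim_transform_eventually)
    have "((\<lambda>z::real. 1 - real k * inverse (ln z)) \<longlongrightarrow> 1 - real k * 0) at_top"
      by (intro tendsto_intros tendsto_inverse_0_at_top ln_at_top)
    then show "((\<lambda>z::real. 1 - real k * inverse (ln z)) \<longlongrightarrow> 1) at_top" by simp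
    show "\<forall>\<^sub>F z in at_top. 1 - real k * inverse (ln z) = z\<^sup>2 * G' z / ln z ^ k"
      using eventually_gt_at_top[of 1]
    proof eventually_elim
      case (elim z)
      then have "ln z > 0" by simp
      then show ?case using elim by (cases k) (auto simp: G'_def field_simps)
    qed
  qed
  have fG: "((\<lambda>z. f z / G' z) \<longlongrightarrow> c) at_top"
  proof (rule Lim_transform_eventually)
    show "((\<lambda>z. (z\<^sup>2 * f z / ln z ^ k) / (z\<^sup>2 * G' z / ln z ^ k)) \<longlongrightarrow> c) at_top"
      using tendsto_divide[OF lim ratio] by simp
    show "\<forall>\<^sub>F z in at_top. (z\<^sup>2 * f z / ln z ^ k) / (z\<^sup>2 * G' z / ln z ^ k) = f z / G' z"
      using eventually_gt_at_top[of 1] by eventually_elim auto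
  qed
  have G'_pos: "\<forall>\<^sub>F z in at_top. G' z > 0"
    using order_tendstoD(1)[OF ratio zero_less_one] eventually_gt_at_top[of 1]
    by eventually_elim (auto simp: zero_less_divide_iff zero_less_mult_iff)
  have G0: "((\<lambda>z. - G z) \<longlongrightarrow> 0) at_top"
    using tendsto_minus[OF tendsto_ln_power_div_at_top[of k]] by (simp add: G_def)
  have G_int: "(\<integral>\<^sup>+x. ennreal (a * G' x) * indicator {z..} x \<partial>lborel) = ennreal (a * G z)"
    if "z > 0" "a \<ge> 0" "\<And>x. x \<ge> z \<Longrightarrow> G' x > 0" for a z
  proof -
    have "(\<integral>\<^sup>+x. ennreal (a * G' x) * indicator {z..} x \<partial>lborel) = ennreal (a * 0 - a * (- G z))"
    proof (rule nn_integral_FTC_atLeast)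
      show "((\<lambda>z. a * (- G z)) has_field_derivative a * G' x) (at x)" if "z \<le> x" for x
        using \<open>z > 0\<close> that by (intro DERIV_cmult G) auto
      show "((\<lambda>z. a * (- G z)) \<longlongrightarrow> a * 0) at_top" by (intro tendsto_intros G0)
      show "0 \<le> a * G' x" if "z \<le> x" for x
        using \<open>a \<ge> 0\<close> \<open>\<And>x. x \<ge> z \<Longrightarrow> G' x > 0\<close>[OF that] by simp
    qed measurable
    then show ?thesis by simp
  qed
  \<comment> \<open>Closing the ray costs only the null set of its endpoint and matches the form of
    \<open>G_int\<close>.\<close>
  have prob_eq: "ennreal (prob {\<omega> \<in> space M. Z \<omega> > z}) =
      (\<integral>\<^sup>+x. ennreal (f x) * indicator {z..} x \<partial>lborel)" for z
  proof -
    have "{\<omega> \<in> space M. Z \<omega> > z} = Z -` {z<..} \<inter> space M" by auto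
    then have "ennreal (prob {\<omega> \<in> space M. Z \<omega> > z}) =
        (\<integral>\<^sup>+x. ennreal (f x) * indicator {z<..} x \<partial>lborel)"
      by (simp add: distributed_emeasure[OF Z] flip: emeasure_eq_measure)
    also have "\<dots> = (\<integral>\<^sup>+x. ennreal (f x) * indicator {z..} x \<partial>lborel)"
      by (rule nn_integral_cong_AE)
         (use AE_lborel_singleton[of z] in \<open>eventually_elim, auto simp: indicator_def\<close>)
    finally show ?thesis .
  qed
  have G_pos: "\<forall>\<^sub>F z in at_top. G z > 0"
    using eventually_gt_at_top[of 1] by eventually_elim (auto simp: G_def)
  have lim: "((\<lambda>z. prob {\<omega> \<in> space M. Z \<omega> > z} / G z) \<longlongrightarrow> c) at_top"
  proof (rule order_tendstoI)
    fix a assume "a < c"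
    \<comment> \<open>A level below \<open>c\<close>, kept nonnegative so that \<open>G_int\<close>
      applies. Integrating \<open>b * G' x \<le> f x\<close> over the ray yields
      \<open>b * G z\<close> as a lower bound of the probability; the upper estimate is
      symmetric.\<close>
    define b where "b = max ((a + c) / 2) 0"
    have b: "a < b \<or> a < 0" "b < c" "b \<ge> 0" using \<open>a < c\<close> c by (auto simp: b_def)
    have "\<forall>\<^sub>F x in at_top. G' x > 0 \<and> f x / G' x > b"
      using G'_pos order_tendstoD(1)[OF fG b(2)] by eventually_elim simp
    then obtain T where T: "\<And>x. x \<ge> T \<Longrightarrow> G' x > 0 \<and> f x / G' x > b"
      by (auto simp: eventually_at_top_linorder)
    show "\<forall>\<^sub>F z in at_top. a < prob {\<omega> \<in> space M. Z \<omega> > z} / G z"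
      using eventually_ge_at_top[of T] eventually_gt_at_top[of 0] G_pos
    proof eventually_elim
      case (elim z)
      have le: "b * G' x \<le> f x" if "x \<ge> z" for x
        using T[of x] that elim by (intro less_imp_le) (auto simp: field_simps)
      have "ennreal (b * G z) = (\<integral>\<^sup>+x. ennreal (b * G' x) * indicator {z..} x \<partial>lborel)"
        using T elim b by (intro G_int[symmetric]) auto
      also have "\<dots> \<le> (\<integral>\<^sup>+x. ennreal (f x) * indicator {z..} x \<partial>lborel)"
        using le by (intro nn_integral_mono) (auto simp: ennreal_leI split: split_indicator)
      finally have "b * G z \<le> prob {\<omega> \<in> space M. Z \<omega> > z}"
        by (simp flip: prob_eq)
      then have "b \<le> prob {\<omega> \<in> space M. Z \<omega> > z} / G z"
        using elim by (simp add: field_simps)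
      then show ?case using b by linarith
    qed
  next
    fix a assume "c < a"
    define b where "b = (a + c) / 2"
    have b: "b < a" "c < b" "b \<ge> 0" using \<open>c < a\<close> c by (auto simp: b_def)
    have "\<forall>\<^sub>F x in at_top. G' x > 0 \<and> f x / G' x < b"
      using G'_pos order_tendstoD(2)[OF fG b(2)] by eventually_elim simp
    then obtain T where T: "\<And>x. x \<ge> T \<Longrightarrow> G' x > 0 \<and> f x / G' x < b"
      by (auto simp: eventually_at_top_linorder)
    show "\<forall>\<^sub>F z in at_top. prob {\<omega> \<in> space M. Z \<omega> > z} / G z < a"
      using eventually_ge_at_top[of T] eventually_gt_at_top[of 0] G_pos
    proof eventually_elim
      case (elim z)
      have le: "f x \<le> b * G' x" if "x \<ge> z" for x
        using T[of x] that elim by (intro less_imp_le) (auto simp: field_simps)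
      have "(\<integral>\<^sup>+x. ennreal (f x) * indicator {z..} x \<partial>lborel) \<le>
          (\<integral>\<^sup>+x. ennreal (b * G' x) * indicator {z..} x \<partial>lborel)"
        using le by (intro nn_integral_mono) (auto simp: ennreal_leI split: split_indicator)
      also have "\<dots> = ennreal (b * G z)"
        using T elim b by (intro G_int) auto
      finally have "prob {\<omega> \<in> space M. Z \<omega> > z} \<le> b * G z"
        using b elim by (simp flip: prob_eq)
      then have "prob {\<omega> \<in> space M. Z \<omega> > z} / G z \<le> b"
        using elim by (simp add: field_simps)
      then show ?case using b by linarith
    qed
  qed
  show ?thesis
  proof (rule asymp_equivI'_const)
    show "((\<lambda>z. prob {\<omega> \<in> space M. Z \<omega> > z} / (ln z ^ k / z)) \<longlongrightarrow> c) at_top"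
      using lim by (simp add: G_def)
    show "c \<noteq> 0" using c by simp
  qed
qed

section \<open>Assembling the factors and the constant\<close>

text \<open>As one product over a disjoint sum of indices, the ratio falls under the independence of
  products over disjoint subfamilies.\<close>

lemma prod_ratio_eq_prod:
  "prod_ratio m n X Y =
    (\<lambda>\<omega>. \<Prod>i\<in>{1..m} <+> {1..n}. case_sum X (\<lambda>j \<omega>. inverse (Y j \<omega>)) i \<omega>)"
  by (rule ext) (simp add: prod_ratio_def prod.Plus o_def divide_inverse prod_inversef[symmetric])

text \<open>The order is: one denominator, all numerators, then the other denominators. A numerator
  contributes \<open>\<sigma> * sqrt (2 / pi)\<close>; a later denominator contributes twice its
  density at 0, that is \<open>sqrt (2 / pi) / \<sigma>\<close>, and a divisor \<open>Suc l\<close>,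
  which accumulates to \<open>fact n\<close>. The first denominator lacks the factor 2, hence the
  division by 2.\<close>

lemma (in prob_space) log_tail_pdf_prod_ratio:
  assumes \<sigma>X: "\<And>i. i \<in> {1..m} \<Longrightarrow> \<sigma>X i > 0"
    and \<sigma>Y: "\<And>j. j \<in> {1..Suc n} \<Longrightarrow> \<sigma>Y j > 0"
    and X: "\<And>i. i \<in> {1..m} \<Longrightarrow> distributed M lborel (X i) (\<lambda>x. ennreal (normal_density 0 (\<sigma>X i) x))"
    and Y: "\<And>j. j \<in> {1..Suc n} \<Longrightarrow> distributed M lborel (Y j) (\<lambda>y. ennreal (normal_density 0 (\<sigma>Y j) y))"
    and indep: "indep_vars (\<lambda>_. borel) (case_sum X Y) ({1..m} <+> {1..Suc n})"
  shows "\<exists>f. log_tail_pdf M (prod_ratio m (Suc n) X Y) n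
    (sqrt (2 / pi) ^ (m + Suc n) / 2 * (\<Prod>i=1..m. \<sigma>X i) / (fact n * (\<Prod>j=1..Suc n. \<sigma>Y j))) f"
proof -
  define V where "V = case_sum X (\<lambda>j \<omega>. inverse (Y j \<omega>))"
  have "indep_vars (\<lambda>_. borel) (\<lambda>i \<omega>. case_sum (\<lambda>_ x. x) (\<lambda>_ x. inverse x) i (case_sum X Y i \<omega>))
      ({1..m} <+> {1..Suc n})"
    by (rule indep_vars_compose2[OF indep]) (auto split: sum.split)
  also have "(\<lambda>i \<omega>. case_sum (\<lambda>_ x. x) (\<lambda>_ x. inverse x) i (case_sum X Y i \<omega>)) = V"
    by (auto simp: V_def fun_eq_iff split: sum.split)
  finally have V: "indep_vars (\<lambda>_. borel) V ({1..m} <+> {1..Suc n})" .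
  have ratio_eq: "prod_ratio k l X Y = (\<lambda>\<omega>. \<Prod>i\<in>{1..k} <+> {1..l}. V i \<omega>)" for k l
    unfolding V_def by (rule prod_ratio_eq_prod)
  have indep_step: "indep_var borel (V i) borel (prod_ratio k l X Y)"
    if "i \<notin> {1..k} <+> {1..l}" "insert i ({1..k} <+> {1..l}) \<subseteq> {1..m} <+> {1..Suc n}" for i k l
    unfolding ratio_eq using that
    by (intro indep_vars_prod indep_vars_subset[OF V]) auto
  have phi0: "normal_density 0 \<sigma> 0 = sqrt (2 / pi) / 2 / \<sigma>" if "\<sigma> > 0" for \<sigma> :: real
    using that real_sqrt_mult_self[of 2]
    by (simp add: normal_density_def real_sqrt_mult real_sqrt_divide field_simps)
  have base: "\<exists>f. log_tail_pdf M (prod_ratio k 1 X Y) 0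
      (sqrt (2 / pi) ^ Suc k / 2 * (\<Prod>i=1..k. \<sigma>X i) / \<sigma>Y 1) f" if "k \<le> m" for k
    using that
  proof (induction k)
    case 0
    have "prod_ratio 0 1 X Y = (\<lambda>\<omega>. inverse (Y 1 \<omega>))"
      by (simp add: prod_ratio_def fun_eq_iff inverse_eq_divide)
    then show ?case
      using log_tail_pdf_inverse_normal[OF Y \<sigma>Y, of 1] \<sigma>Y[of 1] by (auto simp: phi0)
  next
    case (Suc k)
    then obtain f where f: "log_tail_pdf M (prod_ratio k 1 X Y) 0
        (sqrt (2 / pi) ^ Suc k / 2 * (\<Prod>i=1..k. \<sigma>X i) / \<sigma>Y 1) f" by auto
    have "indep_var borel (X (Suc k)) borel (prod_ratio k 1 X Y)"
    proof -
      have "indep_var borel (V (Inl (Suc k))) borel (prod_ratio k 1 X Y)"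
        using Suc.prems by (intro indep_step) auto
      then show ?thesis by (simp add: V_def)
    qed
    from log_tail_pdf_mult_normal[OF f X \<sigma>X this] Suc.prems
    obtain g where "log_tail_pdf M (\<lambda>\<omega>. prod_ratio k 1 X Y \<omega> * X (Suc k) \<omega>) 0
        (sqrt (2 / pi) ^ Suc k / 2 * (\<Prod>i=1..k. \<sigma>X i) / \<sigma>Y 1 * (\<sigma>X (Suc k) * sqrt (2 / pi))) g"
      by auto
    moreover have "(\<lambda>\<omega>. prod_ratio k 1 X Y \<omega> * X (Suc k) \<omega>) = prod_ratio (Suc k) 1 X Y"
      by (simp add: prod_ratio_def fun_eq_iff)
    ultimately show ?case by (auto simp: mult_ac)
  qed
  have "\<exists>f. log_tail_pdf M (prod_ratio m (Suc l) X Y) l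
      (sqrt (2 / pi) ^ (m + Suc l) / 2 * (\<Prod>i=1..m. \<sigma>X i) / (fact l * (\<Prod>j=1..Suc l. \<sigma>Y j))) f"
    if "l \<le> n" for l
    using that
  proof (induction l)
    case 0
    show ?case using base[of m] by simp
  next
    case (Suc l)
    let ?c = "sqrt (2 / pi) ^ (m + Suc l) / 2 * (\<Prod>i=1..m. \<sigma>X i) / (fact l * (\<Prod>j=1..Suc l. \<sigma>Y j))"
    let ?j = "Suc (Suc l)"
    obtain f where f: "log_tail_pdf M (prod_ratio m (Suc l) X Y) l ?c f" using Suc by auto
    have j: "?j \<in> {1..Suc n}" using Suc.prems by simp
    have "indep_var borel (\<lambda>\<omega>. inverse (Y ?j \<omega>)) borel (prod_ratio m (Suc l) X Y)"
    proof -
      have "indep_var borel (V (Inr ?j)) borel (prod_ratio m (Suc l) X Y)"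
        using Suc.prems by (intro indep_step) auto
      then show ?thesis by (simp add: V_def)
    qed
    from log_tail_pdf_divide_normal[OF f Y[OF j] \<sigma>Y[OF j] this]
    obtain g where g: "log_tail_pdf M (\<lambda>\<omega>. prod_ratio m (Suc l) X Y \<omega> * inverse (Y ?j \<omega>)) (Suc l)
        (2 * normal_density 0 (\<sigma>Y ?j) 0 * ?c / real (Suc l)) g" by blast
    have "2 * normal_density 0 (\<sigma>Y ?j) 0 * ?c / real (Suc l) =
        sqrt (2 / pi) ^ (m + ?j) / 2 * (\<Prod>i=1..m. \<sigma>X i) / (fact (Suc l) * (\<Prod>j=1..?j. \<sigma>Y j))"
      using \<sigma>Y[OF j] by (simp add: phi0 mult_ac del: of_nat_Suc)
    moreover have "(\<lambda>\<omega>. prod_ratio m (Suc l) X Y \<omega> * inverse (Y ?j \<omega>)) = prod_ratio m ?j X Y"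
      by (simp add: prod_ratio_def fun_eq_iff divide_inverse)
    ultimately show ?case using g by metis
  qed
  then show ?thesis by simp
qed

theorem theorem2p7:
  fixes P :: "'a measure"
    and M N :: nat
    and X Y :: "nat \<Rightarrow> 'a \<Rightarrow> real"
    and \<sigma>X \<sigma>Y :: "nat \<Rightarrow> real"
  assumes "prob_space P"
    and "N \<ge> 1"
    and "\<And>i. i \<in> {1..M} \<Longrightarrow> \<sigma>X i > 0"
    and "\<And>j. j \<in> {1..N} \<Longrightarrow> \<sigma>Y j > 0"
    and "\<And>i. i \<in> {1..M} \<Longrightarrow> distributed P lborel (X i) (\<lambda>x. ennreal (normal_density 0 (\<sigma>X i) x))"
    and "\<And>j. j \<in> {1..N} \<Longrightarrow> distributed P lborel (Y j) (\<lambda>y. ennreal (normal_density 0 (\<sigma>Y j) y))"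
    and "prob_space.indep_vars P (\<lambda>_. borel) (case_sum X Y) ({1..M} <+> {1..N})"
  shows "(\<exists>f. pdf_cont_off_zero P (prod_ratio M N X Y) f)
       \<and> (\<forall>f. pdf_cont_off_zero P (prod_ratio M N X Y) f \<longrightarrow>
            f \<sim>[at_infinity]
              (\<lambda>z. 2 powr ((real M + real N - 2) / 2) * (\<Prod>i=1..M. \<sigma>X i)
                   / (pi powr ((real N + real M) / 2) * fact (N - 1) * (\<Prod>j=1..N. \<sigma>Y j))
                   * (ln \<bar>z\<bar> ^ (N - 1) / z\<^sup>2)))
       \<and> (\<lambda>z. measure P {\<omega> \<in> space P. prod_ratio M N X Y \<omega> > z}) \<sim>[at_top]
              (\<lambda>z. 2 powr ((real M + real N - 2) / 2) * (\<Prod>i=1..M. \<sigma>X i)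
                   / (pi powr ((real M + real N) / 2) * fact (N - 1) * (\<Prod>j=1..N. \<sigma>Y j))
                   * (ln z ^ (N - 1) / z))"
proof -
  interpret prob_space P by fact
  let ?Z = "prod_ratio M N X Y"
  define c where "c = 2 powr ((real M + real N - 2) / 2) * (\<Prod>i=1..M. \<sigma>X i)
      / (pi powr ((real M + real N) / 2) * fact (N - 1) * (\<Prod>j=1..N. \<sigma>Y j))"
  obtain n where n: "N = Suc n" using assms(2) by (cases N) auto
  have half: "sqrt x ^ (M + N) = x powr ((real M + real N) / 2)" if "x > 0" for x
    using that by (simp add: powr_half_sqrt[symmetric] powr_powr flip: powr_realpow)
  have p2: "2 powr ((real M + real N - 2) / 2) = 2 powr ((real M + real N) / 2) / (2 :: real)"
    by (simp add: diff_divide_distrib powr_diff)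
  \<comment> \<open>The division by 2 turns the exponent \<open>(M + N) / 2\<close> of 2 into
    \<open>(M + N - 2) / 2\<close>.\<close>
  have c_eq: "sqrt (2 / pi) ^ (M + N) / 2 * (\<Prod>i=1..M. \<sigma>X i) / (fact (N - 1) * (\<Prod>j=1..N. \<sigma>Y j)) = c"
    unfolding c_def p2 by (simp add: half powr_divide field_simps)
  have c: "c > 0"
    unfolding c_def using assms(3,4) by (intro divide_pos_pos mult_pos_pos prod_pos) auto
  obtain f where f: "log_tail_pdf P ?Z (N - 1) c f"
    using log_tail_pdf_prod_ratio[of M \<sigma>X n \<sigma>Y X Y] assms(3-7) c_eq unfolding n by auto
  then have fZ: "pdf_cont_off_zero P ?Z f" and even: "\<And>z. f (- z) = f z"
    and lim: "((\<lambda>z. z\<^sup>2 * f z / ln z ^ (N - 1)) \<longlongrightarrow> c) at_top"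
    by (auto simp: log_tail_pdf_def)
  have "h \<sim>[at_infinity] (\<lambda>z. c * (ln \<bar>z\<bar> ^ (N - 1) / z\<^sup>2))" if h: "pdf_cont_off_zero P ?Z h" for h
  proof (rule asymp_equivI'_const)
    \<comment> \<open>Composing with the absolute value moves the limit to
      \<open>at_infinity\<close>. Evenness then removes it inside \<open>f\<close>, and uniqueness
      off 0 replaces \<open>f\<close> by the arbitrary version \<open>h\<close>.\<close>
    have "((\<lambda>z. \<bar>z\<bar>\<^sup>2 * f \<bar>z\<bar> / ln \<bar>z\<bar> ^ (N - 1)) \<longlongrightarrow> c) at_infinity"
      using filterlim_compose[OF lim filterlim_norm_at_top[where 'a=real]] by (simp only: real_norm_def)
    moreover have "\<forall>\<^sub>F z in at_infinity. \<bar>z\<bar>\<^sup>2 * f \<bar>z\<bar> / ln \<bar>z\<bar> ^ (N - 1) = h z / (ln \<bar>z\<bar> ^ (N - 1) / z\<^sup>2)"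
      using eventually_not_equal_at_infinity[of 0]
    proof eventually_elim
      case (elim z)
      have "f \<bar>z\<bar> = f z" using even[of z] by (simp add: abs_if)
      then show ?case using pdf_cont_off_zero_unique[OF h fZ elim] by simp
    qed
    ultimately show "((\<lambda>z. h z / (ln \<bar>z\<bar> ^ (N - 1) / z\<^sup>2)) \<longlongrightarrow> c) at_infinity"
      by (rule Lim_transform_eventually)
  qed (use c in simp)
  moreover have "(\<lambda>z. prob {\<omega> \<in> space P. ?Z \<omega> > z}) \<sim>[at_top] (\<lambda>z. c * (ln z ^ (N - 1) / z))"
    using fZ by (intro tail_prob_asymp[OF _ _ borel_measurable_pdf_cont_off_zero[OF fZ] lim c])
      (auto simp: pdf_cont_off_zero_def)
  ultimately show ?thesis
    using fZ unfolding add.commute[of "real N" "real M"] c_def[symmetric] by blast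
qed

end
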